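(* Let $X_{\mathrm{d},k}:\mathbb{R}^2\to\mathbb{R}$ (for each space index $k$) and $F:\mathbb{R}^2\to\mathbb{R}$ be $C^1$ functions. For $\boldsymbol{U}^{(n)}=\{U_k^{(n)}\}_{k=-1}^{K+1}\in\mathbb{R}^{K+3}$ $(n=0,1,\ldots,N)$ write $$Q_k^{(n)}:=\frac{d(X_{\mathrm{d},k},\mathrm{loc})}{d(\delta_k^+U_k^{(n+1)},\delta_k^+U_k^{(n)}:\delta_k^+U_k^{(n)},\delta_k^+U_k^{(n-1)})}\qquad(k=-1,\ldots,K,\ n=1,\ldots,N-1).$$ Suppose that $\boldsymbol{U}^{(n)}$ $(n=0,1,\ldots,N)$ satisfies the difference scheme $$\delta_n^{\langle2\rangle}U_k^{(n)}=\delta_k^-Q_k^{(n)}-\frac{d(F,\mathrm{loc})}{d(U_k^{(n+1)},U_k^{(n)}:U_k^{(n)},U_k^{(n-1)})}\qquad(k=0,\ldots,K,\ n=1,\ldots,N-1),$$ $$\delta_n^{\langle2\rangle}U_0^{(n)}-\mu_k^-Q_0^{(n)}=0\qquad(n=1,\ldots,N-1),$$ $$\delta_n^{\langle2\rangle}U_K^{(n)}+\mu_k^-Q_K^{(n)}=0\qquad(n=1,\ldots,N-1).$$ Then $\delta_n^-J_{\mathrm{d}}(\boldsymbol{U}^{(n+1)},\boldsymbol{U}^{(n)})=0$ for all $n=1,\ldots,N-1$, where $$J_{\mathrm{d}}(\boldsymbol{U}^{(n+1)},\boldsymbol{U}^{(n)})=\sum_{k=0}^K{}''\frac12(\delta_n^+U_k^{(n)})^2\Delta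 x+\sum_{k=0}^{K-1}X_{\mathrm{d},k}(\delta_k^+U_k^{(n+1)},\delta_k^+U_k^{(n)})\Delta x+\sum_{k=0}^K{}''F(U_k^{(n+1)},U_k^{(n)})\Delta x+\frac12(\delta_n^+U_0^{(n)})^2+\frac12(\delta_n^+U_K^{(n)})^2.$$
   Context: Let $L,T>0$, let $N,K$ be positive integers, $\Delta t=T/N$, $\Delta x=L/K$. For a family $f_k^{(n)}$ (time index $n$, space index $k$): $\delta_n^+f_k^{(n)}=\frac{f_k^{(n+1)}-f_k^{(n)}}{\Delta t}$, $\delta_k^+f_k^{(n)}=\frac{f_{k+1}^{(n)}-f_k^{(n)}}{\Delta x}$, $\delta_k^-f_k^{(n)}=\frac{f_k^{(n)}-f_{k-1}^{(n)}}{\Delta x}$, $\mu_k^-f_k^{(n)}=\frac{f_k^{(n)}+f_{k-1}^{(n)}}{2}$, $\delta_n^{\langle2\rangle}f_k^{(n)}=\frac{f_k^{(n+1)}-2f_k^{(n)}+f_k^{(n-1)}}{(\Delta t)^2}$. The operators $\delta_k^-$ and $\mu_k^-$ applied to $Q_k^{(n)}$ act on the full space index $k$ (including the index of $X_{\mathrm d,k}$), so e.g. $\mu_k^-Q_0^{(n)}=\frac12(Q_0^{(n)}+Q_{-1}^{(n)})$; the functions $X_{\mathrm d,k}$ are given for $k=-1,\ldots,K$. The operator $\delta_n^-$ is the backward difference in $n$: $\delta_n^-J_{\mathrm d}(\boldsymbol U^{(n+1)},\boldsymbol U^{(n)})=\frac{1}{\Delta t}\left(J_{\mathrm d}(\boldsymbol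 U^{(n+1)},\boldsymbol U^{(n)})-J_{\mathrm d}(\boldsymbol U^{(n)},\boldsymbol U^{(n-1)})\right)$. Trapezoidal sum: $\sum_{k=0}^K{}''f_k\Delta x=\frac12f_0\Delta x+\sum_{k=1}^{K-1}f_k\Delta x+\frac12f_K\Delta x$. Four-point difference quotient of a $C^1$ function $f:\mathbb{R}^2\to\mathbb{R}$: with $\mathrm{loc}(a,b)=\frac12(a+b)$, $$\frac{d(f,\mathrm{loc})}{d(a,b:c,d)}=\begin{cases}\dfrac{f(a,b)-f(c,d)}{\mathrm{loc}(a,b)-\mathrm{loc}(c,d)}&(\mathrm{loc}(a,b)\neq\mathrm{loc}(c,d)),\\[2mm]\left.\dfrac{d f(x,x)}{dx}\right|_{x=\mathrm{loc}(a,b)}&(\mathrm{loc}(a,b)=\mathrm{loc}(c,d)).\end{cases}$$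
   Formalization: Added assumption: wherever a difference quotient of F (k=0..K) or X_{d,k} (k=0..K-1) in the scheme has loc(a,b)=loc(c,d), also f(a,b)=f(c,d); automatic for symmetric functions. Without it the claim fails for some C^1 functions. *)

theory Defs
  imports "HOL-Analysis.Analysis"
begin

text \<open>
  Grid functions are total functions on \<^typ>\<open>int\<close>; only the indices mentioned in a statement matter.
  \<open>U n k\<close> is the value at time index \<open>n\<close> and space index \<open>k\<close>, so \<open>U n\<close> is the vector at time \<open>n\<close>.
  The one-variable operators below are used in time as \<open>op dt (\<lambda>m. U m k) n\<close> and in space
  as \<open>op dx (U n) k\<close>.
\<close>

definition fwd_diff :: "real \<Rightarrow> (int \<Rightarrow> real) \<Rightarrow> int \<Rightarrow> real" where
  "fwd_diff h f i = (f (i + 1) - f i) / h"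

definition bwd_diff :: "real \<Rightarrow> (int \<Rightarrow> real) \<Rightarrow> int \<Rightarrow> real" where
  "bwd_diff h f i = (f i - f (i - 1)) / h"

definition bwd_mean :: "(int \<Rightarrow> real) \<Rightarrow> int \<Rightarrow> real" where
  "bwd_mean f i = (f i + f (i - 1)) / 2"

definition second_diff :: "real \<Rightarrow> (int \<Rightarrow> real) \<Rightarrow> int \<Rightarrow> real" where
  "second_diff h f i = (f (i + 1) - 2 * f i + f (i - 1)) / h\<^sup>2"

definition trapezoidal_sum :: "real \<Rightarrow> int \<Rightarrow> (int \<Rightarrow> real) \<Rightarrow> real" where
  "trapezoidal_sum h K f = 1/2 * f 0 * h + (\<Sum>k\<in>{1..K - 1}. f k * h) + 1/2 * f K * h"

definition C1_plane :: "(real \<times> real \<Rightarrow> real) \<Rightarrow> bool" where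
  "C1_plane f \<longleftrightarrow> (\<exists>f' :: real \<times> real \<Rightarrow> (real \<times> real) \<Rightarrow>\<^sub>L real.
     (\<forall>z. (f has_derivative blinfun_apply (f' z)) (at z)) \<and> continuous_on UNIV f')"

definition loc :: "real \<Rightarrow> real \<Rightarrow> real" where
  "loc a b = (a + b) / 2"

definition four_point_quotient ::
    "(real \<times> real \<Rightarrow> real) \<Rightarrow> real \<Rightarrow> real \<Rightarrow> real \<Rightarrow> real \<Rightarrow> real" where
  "four_point_quotient f a b c d =
     (if loc a b \<noteq> loc c d then (f (a, b) - f (c, d)) / (loc a b - loc c d)
      else deriv (\<lambda>x. f (x, x)) (loc a b))"

text \<open>
  \<open>f\<close> takes equal values at \<open>(a, b)\<close> and \<open>(c, d)\<close> if the denominator of the four-point quotient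
  vanishes there. Only then does the quotient times \<open>loc a b - loc c d\<close> always equal
  \<open>f (a, b) - f (c, d)\<close>. For the arguments \<open>(a, b)\<close>, \<open>(b, c)\<close> occurring in the scheme this is
  automatic for symmetric \<open>f\<close>, but not for every continuously differentiable \<open>f\<close>, and discrete
  energy conservation fails without it.
\<close>
definition quotient_consistent ::
    "(real \<times> real \<Rightarrow> real) \<Rightarrow> real \<Rightarrow> real \<Rightarrow> real \<Rightarrow> real \<Rightarrow> bool" where
  "quotient_consistent f a b c d \<longleftrightarrow> (loc a b = loc c d \<longrightarrow> f (a, b) = f (c, d))"

lemma quotient_consistent_symmetric:
  assumes "\<And>x y. f (x, y) = f (y, x)"
  shows "quotient_consistent f a b b c"
  using assms by (simp add: quotient_consistent_def loc_def)

definition flux ::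
    "real \<Rightarrow> (int \<Rightarrow> real \<times> real \<Rightarrow> real) \<Rightarrow> (int \<Rightarrow> int \<Rightarrow> real) \<Rightarrow> int \<Rightarrow> int \<Rightarrow> real" where
  "flux dx X U n k = four_point_quotient (X k)
     (fwd_diff dx (U (n + 1)) k) (fwd_diff dx (U n) k)
     (fwd_diff dx (U n) k) (fwd_diff dx (U (n - 1)) k)"

text \<open>\<open>V\<close> is the newer vector and \<open>W\<close> the older one, so \<open>(V k - W k) / dt\<close> is the forward
  difference quotient in time.\<close>
definition discrete_energy ::
    "real \<Rightarrow> real \<Rightarrow> int \<Rightarrow> (int \<Rightarrow> real \<times> real \<Rightarrow> real) \<Rightarrow> (real \<times> real \<Rightarrow> real) \<Rightarrow>
     (int \<Rightarrow> real) \<Rightarrow> (int \<Rightarrow> real) \<Rightarrow> real" where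
  "discrete_energy dt dx K X F V W =
     trapezoidal_sum dx K (\<lambda>k. 1/2 * ((V k - W k) / dt)\<^sup>2)
     + (\<Sum>k\<in>{0..K - 1}. X k (fwd_diff dx V k, fwd_diff dx W k) * dx)
     + trapezoidal_sum dx K (\<lambda>k. F (V k, W k))
     + 1/2 * ((V 0 - W 0) / dt)\<^sup>2
     + 1/2 * ((V K - W K) / dt)\<^sup>2"

end

theory Submission
  imports Defs
begin

text \<open>
  Multiply the scheme by \<open>w k = (U (n + 1) k - U (n - 1) k) / 2\<close>, the increment of
  \<open>loc (U (m + 1) k) (U m k)\<close> from \<open>m = n - 1\<close> to \<open>m = n\<close>. The second difference then becomes
  the increment of the kinetic energy, the four-point quotient of \<open>F\<close> becomes the increment of
  \<open>F\<close>, and summation by parts turns the flux term into the increment of the \<open>X\<close> part of the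
  energy up to boundary terms. The boundary conditions make these the increments of the two
  boundary energies.
\<close>

lemma trapezoidal_sum_add:
  "trapezoidal_sum h K (\<lambda>k. f k + g k) = trapezoidal_sum h K f + trapezoidal_sum h K g"
  by (simp add: trapezoidal_sum_def sum.distrib algebra_simps add_divide_distrib)

lemma trapezoidal_sum_diff:
  "trapezoidal_sum h K (\<lambda>k. f k - g k) = trapezoidal_sum h K f - trapezoidal_sum h K g"
  by (simp add: trapezoidal_sum_def sum_subtractf algebra_simps diff_divide_distrib)

lemma trapezoidal_sum_cong:
  assumes "K \<ge> 0" "\<And>k. k \<in> {0..K} \<Longrightarrow> f k = g k"
  shows "trapezoidal_sum h K f = trapezoidal_sum h K g"
  using assms by (simp add: trapezoidal_sum_def)

text \<open>The half weights at the two ends are what turns the boundary terms into the means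
  \<open>bwd_mean q 0\<close> and \<open>bwd_mean q K\<close>, the form in which the boundary
  conditions are stated. The value \<open>q (-1)\<close> enters through the left end only.\<close>

lemma trapezoidal_summation_by_parts:
  assumes "h \<noteq> 0" "K \<ge> 1"
  shows "trapezoidal_sum h K (\<lambda>k. bwd_diff h q k * w k)
           + (\<Sum>k\<in>{0..K - 1}. q k * fwd_diff h w k * h)
         = bwd_mean q K * w K - bwd_mean q 0 * w 0"
proof -
  have cancel: "bwd_diff h q k * w k * h = (q k - q (k - 1)) * w k"
    "q k * fwd_diff h w k * h = q k * (w (k + 1) - w k)" for k
    using \<open>h \<noteq> 0\<close> by (simp_all add: bwd_diff_def fwd_diff_def)
  have "trapezoidal_sum h K (\<lambda>k. bwd_diff h q k * w k)
      = 1/2 * ((q 0 - q (-1)) * w 0) + (\<Sum>k\<in>{1..K - 1}. (q k - q (k - 1)) * w k)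
        + 1/2 * ((q K - q (K - 1)) * w K)"
    unfolding trapezoidal_sum_def mult.assoc[of "1/2"] cancel by simp
  moreover have "1/2 * ((q 0 - q (-1)) * w 0) + (\<Sum>k\<in>{1..K - 1}. (q k - q (k - 1)) * w k)
        + 1/2 * ((q K - q (K - 1)) * w K) + (\<Sum>k\<in>{0..K - 1}. q k * (w (k + 1) - w k))
      = bwd_mean q K * w K - bwd_mean q 0 * w 0"
    using \<open>K \<ge> 1\<close>
  proof (induction K rule: int_ge_induct)
    case base
    show ?case
      by (simp add: bwd_mean_def field_simps)
  next
    case (step K)
    \<comment> \<open>Extending the grid by one node raises the weight at \<open>K\<close> from one
      half to one and adds a half-weighted node \<open>K + 1\<close> and the cell between them;
      together these contribute
      \<open>bwd_mean q (K + 1) * w (K + 1) - bwd_mean q K * w K\<close>.\<close>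
    have "{1..K} = insert K {1..K - 1}" "{0..K} = insert K {0..K - 1}"
      using \<open>1 \<le> K\<close> by auto
    then show ?case
      using step.IH by (simp add: bwd_mean_def field_simps)
  qed
  ultimately show ?thesis
    unfolding cancel by simp
qed

text \<open>In the derivative branch the factor \<open>loc a b - loc c d\<close> is 0, and
  consistency makes the right-hand side 0 as well.\<close>

lemma four_point_quotient_mult:
  assumes "quotient_consistent f a b c d"
  shows "four_point_quotient f a b c d * (loc a b - loc c d) = f (a, b) - f (c, d)"
  using assms by (simp add: four_point_quotient_def quotient_consistent_def)

text \<open>A difference of two squares: the difference of the one-step increments is the second
  difference, their sum is the two-step increment. For \<open>h = 0\<close> both sides are
  0.\<close>

lemma kinetic_energy_increment:
  "1/2 * ((f (n + 1) - f n) / h)\<^sup>2 - 1/2 * ((f n - f (n - 1)) / h)\<^sup>2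
     = second_diff h f n * ((f (n + 1) - f (n - 1)) / 2)"
proof -
  have "(f (n + 1) - f n)\<^sup>2 - (f n - f (n - 1))\<^sup>2
      = (f (n + 1) - 2 * f n + f (n - 1)) * (f (n + 1) - f (n - 1))"
    by (simp add: power2_eq_square algebra_simps)
  then show ?thesis
    by (simp add: second_diff_def power_divide flip: diff_divide_distrib)
qed

theorem theorem3p2:
  fixes L T dx dt :: real and N K :: nat
    and X :: "int \<Rightarrow> real \<times> real \<Rightarrow> real"
    and F :: "real \<times> real \<Rightarrow> real"
    and U :: "int \<Rightarrow> int \<Rightarrow> real"
  assumes "L > 0" "T > 0" "N > 0" "K > 0"
    and dt: "dt = T / real N"
    and dx: "dx = L / real K"
    and C1_X: "\<forall>k\<in>{-1..int K}. C1_plane (X k)"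
    and C1_F: "C1_plane F"
    and consistent_X: "\<forall>n\<in>{1..int N - 1}. \<forall>k\<in>{0..int K - 1}.
        quotient_consistent (X k)
          (fwd_diff dx (U (n + 1)) k) (fwd_diff dx (U n) k)
          (fwd_diff dx (U n) k) (fwd_diff dx (U (n - 1)) k)"
    and consistent_F: "\<forall>n\<in>{1..int N - 1}. \<forall>k\<in>{0..int K}.
        quotient_consistent F (U (n + 1) k) (U n k) (U n k) (U (n - 1) k)"
    and scheme: "\<forall>n\<in>{1..int N - 1}. \<forall>k\<in>{0..int K}.
        second_diff dt (\<lambda>m. U m k) n =
          bwd_diff dx (flux dx X U n) k
          - four_point_quotient F (U (n + 1) k) (U n k) (U n k) (U (n - 1) k)"
    and boundary_0: "\<forall>n\<in>{1..int N - 1}.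
        second_diff dt (\<lambda>m. U m 0) n - bwd_mean (flux dx X U n) 0 = 0"
    and boundary_K: "\<forall>n\<in>{1..int N - 1}.
        second_diff dt (\<lambda>m. U m (int K)) n + bwd_mean (flux dx X U n) (int K) = 0"
  shows "\<forall>n\<in>{1..int N - 1}.
        bwd_diff dt (\<lambda>m. discrete_energy dt dx (int K) X F (U (m + 1)) (U m)) n = 0"
proof
  fix n assume n: "n \<in> {1..int N - 1}"
  have "dx \<noteq> 0" and K: "int K \<ge> 1"
    using \<open>L > 0\<close> \<open>K > 0\<close> dx by auto
  define A where "A k = second_diff dt (\<lambda>m. U m k) n" for k
  define w where "w k = (U (n + 1) k - U (n - 1) k) / 2" for k
  define G where "G k = four_point_quotient F (U (n + 1) k) (U n k) (U n k) (U (n - 1) k)" for k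
  define q where "q = flux dx X U n"
  define S where "S = trapezoidal_sum dx (int K)"
  define E where "E m = discrete_energy dt dx (int K) X F (U (m + 1)) (U m)" for m
  have kin: "1/2 * ((U (n + 1) k - U n k) / dt)\<^sup>2 - 1/2 * ((U n k - U (n - 1) k) / dt)\<^sup>2
      = A k * w k" for k
    unfolding A_def w_def by (rule kinetic_energy_increment)
  have pot: "F (U (n + 1) k, U n k) - F (U n k, U (n - 1) k) = G k * w k"
    if "k \<in> {0..int K}" for k
  proof -
    have "loc (U (n + 1) k) (U n k) - loc (U n k) (U (n - 1) k) = w k"
      by (simp add: loc_def w_def field_simps)
    then show ?thesis
      using consistent_F n that four_point_quotient_mult unfolding G_def by metis
  qed
  \<comment> \<open>The space difference commutes with \<open>loc\<close> by linearity, so the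
    increment of \<open>loc\<close> on the gradients is the gradient of \<open>w\<close>.\<close>
  have grad: "X k (fwd_diff dx (U (n + 1)) k, fwd_diff dx (U n) k)
        - X k (fwd_diff dx (U n) k, fwd_diff dx (U (n - 1)) k) = q k * fwd_diff dx w k"
    if "k \<in> {0..int K - 1}" for k
  proof -
    have "loc (fwd_diff dx (U (n + 1)) k) (fwd_diff dx (U n) k)
        - loc (fwd_diff dx (U n) k) (fwd_diff dx (U (n - 1)) k) = fwd_diff dx w k"
      using \<open>dx \<noteq> 0\<close> by (simp add: loc_def w_def fwd_diff_def field_simps)
    then show ?thesis
      using consistent_X n that four_point_quotient_mult unfolding q_def flux_def by metis
  qed
  have "E n - E (n - 1)
      = S (\<lambda>k. 1/2 * ((U (n + 1) k - U n k) / dt)\<^sup>2 - 1/2 * ((U n k - U (n - 1) k) / dt)\<^sup>2)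
        + (\<Sum>k\<in>{0..int K - 1}. (X k (fwd_diff dx (U (n + 1)) k, fwd_diff dx (U n) k)
            - X k (fwd_diff dx (U n) k, fwd_diff dx (U (n - 1)) k)) * dx)
        + S (\<lambda>k. F (U (n + 1) k, U n k) - F (U n k, U (n - 1) k))
        + (1/2 * ((U (n + 1) 0 - U n 0) / dt)\<^sup>2 - 1/2 * ((U n 0 - U (n - 1) 0) / dt)\<^sup>2)
        + (1/2 * ((U (n + 1) (int K) - U n (int K)) / dt)\<^sup>2
            - 1/2 * ((U n (int K) - U (n - 1) (int K)) / dt)\<^sup>2)"
    unfolding E_def S_def discrete_energy_def trapezoidal_sum_diff left_diff_distrib sum_subtractf
    by simp
  \<comment> \<open>Besides the trapezoidal sum, \<open>kin\<close> also rewrites the two boundary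
    energies, at the nodes 0 and \<open>int K\<close>.\<close>
  also have "\<dots> = S (\<lambda>k. A k * w k) + (\<Sum>k\<in>{0..int K - 1}. q k * fwd_diff dx w k * dx)
        + S (\<lambda>k. G k * w k) + A 0 * w 0 + A (int K) * w (int K)"
    unfolding kin S_def using trapezoidal_sum_cong[OF _ pot] grad by simp
  also have "\<dots> = S (\<lambda>k. A k * w k + G k * w k)
        + (\<Sum>k\<in>{0..int K - 1}. q k * fwd_diff dx w k * dx) + A 0 * w 0 + A (int K) * w (int K)"
    by (simp add: S_def trapezoidal_sum_add)
  \<comment> \<open>The scheme is imposed at both end nodes too, so the replacement is valid
    throughout the trapezoidal sum.\<close>
  also have "S (\<lambda>k. A k * w k + G k * w k) = S (\<lambda>k. bwd_diff dx q k * w k)"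
    unfolding S_def
  proof (rule trapezoidal_sum_cong)
    fix k assume "k \<in> {0..int K}"
    then have "A k = bwd_diff dx q k - G k"
      using scheme n unfolding A_def G_def q_def by blast
    then show "A k * w k + G k * w k = bwd_diff dx q k * w k"
      by (simp add: left_diff_distrib)
  qed simp
  also have "S (\<lambda>k. bwd_diff dx q k * w k) + (\<Sum>k\<in>{0..int K - 1}. q k * fwd_diff dx w k * dx)
      = bwd_mean q (int K) * w (int K) - bwd_mean q 0 * w 0"
    unfolding S_def using \<open>dx \<noteq> 0\<close> K by (rule trapezoidal_summation_by_parts)
  \<comment> \<open>Grouping by end node makes each coefficient the left-hand side of one boundary
    condition.\<close>
  also have "\<dots> + A 0 * w 0 + A (int K) * w (int K)
      = (A 0 - bwd_mean q 0) * w 0 + (A (int K) + bwd_mean q (int K)) * w (int K)"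
    by (simp add: algebra_simps)
  also have "\<dots> = 0"
    using boundary_0 boundary_K n unfolding A_def q_def by simp
  finally show "bwd_diff dt (\<lambda>m. discrete_energy dt dx (int K) X F (U (m + 1)) (U m)) n = 0"
    by (simp add: E_def bwd_diff_def)
qed

end
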